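(* Let $n \in \mathbb{Z}^+$. Then $\mathcal{P}_{n,2n}$ is not a polyhedral cone.
   Context: For a positive integer $n$, let $\mathsf{M}_n^{\geq 0}$ denote the set of $n\times n$ real matrices with all entries nonnegative. Define $\mathcal{P}_n = \{ p \in \mathbb{R}[x] : p(A) \geq 0 \text{ for all } A \in \mathsf{M}_n^{\geq 0}\}$, where $p(A)\ge 0$ means that the matrix $p(A)$ is entrywise nonnegative. For a nonnegative integer $m$, define $\mathcal{P}_{n,m} = \{ p \in \mathcal{P}_n : \deg(p) \leq m \}$ (the zero polynomial included). $\mathcal{P}_{n,m}$ is a convex cone in the $(m+1)$-dimensional real vector space of polynomials of degree at most $m$. A cone is polyhedral if it is finitely generated, i.e. equal to $\text{cone}(S) = \{ \sum_{i=1}^k \alpha_i x_i : x_i \in S, \alpha_i \in \mathbb{R}, \alpha_i \ge 0, k \in \mathbb{N} \}$ for some finite set $S$. *)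

theory Defs
  imports "Jordan_Normal_Form.Matrix" "HOL-Computational_Algebra.Polynomial"
begin

text \<open>The value of a polynomial at a square matrix: the linear combination of the powers
  \<open>A\<^sup>k\<close> (with \<open>A\<^sup>0\<close> the identity matrix) by the coefficients, written entrywise.
  Meaningful for square matrices only.\<close>

definition poly_mat :: "'a :: comm_semiring_1 poly \<Rightarrow> 'a mat \<Rightarrow> 'a mat" where
  "poly_mat p A = mat (dim_row A) (dim_col A)
     (\<lambda>(i, j). \<Sum>k\<le>degree p. coeff p k * (A ^\<^sub>m k) $$ (i, j))"

text \<open>The library order on matrices is entrywise comparison of matrices of equal dimensions,
  so \<open>0\<^sub>m n n \<le> A\<close> says that \<open>A\<close> is entrywise nonnegative.\<close>

definition nonneg_matrices :: "nat \<Rightarrow> real mat set" where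
  "nonneg_matrices n = {A \<in> carrier_mat n n. 0\<^sub>m n n \<le> A}"

definition nonneg_preserving_polys :: "nat \<Rightarrow> real poly set" where
  "nonneg_preserving_polys n = {p. \<forall>A \<in> nonneg_matrices n. 0\<^sub>m n n \<le> poly_mat p A}"

definition nonneg_preserving_polys_deg :: "nat \<Rightarrow> nat \<Rightarrow> real poly set" where
  "nonneg_preserving_polys_deg n m = {p \<in> nonneg_preserving_polys n. degree p \<le> m}"

text \<open>Real polynomials are not an instance of \<open>real_vector\<close> in the library; scalar
  multiplication is \<open>smult\<close>. The empty combination (\<open>k = 0\<close>) is allowed, so the cone of
  the empty set is \<open>{0}\<close>.\<close>

definition cone_of :: "real poly set \<Rightarrow> real poly set" where
  "cone_of S = {q. \<exists>k (\<alpha> :: nat \<Rightarrow> real) x.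
     (\<forall>i<k. \<alpha> i \<ge> 0 \<and> x i \<in> S) \<and> q = (\<Sum>i<k. smult (\<alpha> i) (x i))}"

definition polyhedral_cone :: "real poly set \<Rightarrow> bool" where
  "polyhedral_cone C \<longleftrightarrow> (\<exists>S. finite S \<and> C = cone_of S)"

end

theory Submission
  imports Defs
begin

text \<open>The proof compares the constant coefficient \<open>p\<^sub>0\<close> with the middle coefficient
  \<open>p\<^sub>n\<close>. Let \<open>C\<close> be the cyclic permutation matrix of order \<open>n\<close>. In the corner entry of
  \<open>p(s C)\<close> only the powers divisible by \<open>n\<close> survive, so every \<open>p\<close> in the cone satisfies
  \<open>p\<^sub>0 + p\<^sub>n s\<^sup>n + p\<^sub>2\<^sub>n s\<^sup>2\<^sup>n \<ge> 0\<close> for all \<open>s \<ge> 0\<close>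
  (\<open>nonneg_preserving_quadratic\<close>). Hence \<open>p\<^sub>0 \<ge> 0\<close>, and \<open>p\<^sub>0 = 0\<close> forces \<open>p\<^sub>n \<ge> 0\<close>. If the
  cone had finitely many generators, a single constant \<open>K\<close> would therefore give
  \<open>p\<^sub>n \<ge> - K p\<^sub>0\<close> on all of it (\<open>finitely_generated_coeff_bound\<close>).

  No such \<open>K\<close> exists. The cone is invariant under the substitution of \<open>\<tau> x\<close> for \<open>x\<close> with
  \<open>\<tau> > 0\<close>, which multiplies \<open>p\<^sub>n / p\<^sub>0\<close> by \<open>\<tau>\<^sup>n\<close>; so one member with \<open>p\<^sub>n < 0\<close> is enough. Such
  a member is \<open>n\<^sup>n (\<Sum>k \<noteq> n. x\<^sup>k) - x\<^sup>n\<close>, with \<open>k\<close> ranging over the other exponents up to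
  \<open>2 n\<close>. The reason is combinatorial: an entry of \<open>A\<^sup>n\<close> is a sum of weights of walks of
  length \<open>n\<close>, and such a walk on \<open>n\<close> vertices contains a closed part, of some length
  \<open>d \<le> n\<close>. Deleting this part gives a walk of length \<open>n - d\<close>, and traversing it twice gives a
  walk of length \<open>n + d\<close>. The weight of the original walk is the geometric mean of these two
  weights, hence at most their arithmetic mean (\<open>closed_walk_am_gm\<close>), and so it is controlled
  by the entries of \<open>A\<^sup>n\<^sup>-\<^sup>d\<close> and \<open>A\<^sup>n\<^sup>+\<^sup>d\<close>. Applied only to one walk that carries at least
  the fraction \<open>1 / n\<^sup>n\<close> of the entry (\<open>exists_heavy_walk\<close>), this gives the coefficient \<open>n\<^sup>n\<close>
  without counting how many walks are shortened to the same one
  (\<open>middle_power_le_other_powers\<close>).\<close>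

section \<open>Polynomials at matrices, entrywise\<close>

lemma poly_mat_index:
  assumes "A \<in> carrier_mat n n" "i < n" "j < n" "degree p \<le> m"
  shows "poly_mat p A $$ (i, j) = (\<Sum>k\<le>m. coeff p k * (A ^\<^sub>m k) $$ (i, j))"
proof -
  have "(\<Sum>k\<le>degree p. coeff p k * (A ^\<^sub>m k) $$ (i, j)) = (\<Sum>k\<le>m. coeff p k * (A ^\<^sub>m k) $$ (i, j))"
    using assms(4) by (intro sum.mono_neutral_left) (auto simp: coeff_eq_0)
  then show ?thesis
    using assms(1-3) by (simp add: poly_mat_def)
qed

lemma mem_nonneg_matrices_iff:
  "A \<in> nonneg_matrices n \<longleftrightarrow> A \<in> carrier_mat n n \<and> (\<forall>i<n. \<forall>j<n. 0 \<le> A $$ (i, j))"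
proof (cases "A \<in> carrier_mat n n")
  case True
  then have "dim_row A = n" "dim_col A = n"
    by auto
  with True show ?thesis
    unfolding nonneg_matrices_def less_eq_mat_def by simp
next
  case False
  then show ?thesis
    unfolding nonneg_matrices_def by blast
qed

text \<open>Summing up to a common bound \<open>m\<close> instead of the degree of \<open>p\<close> makes the condition
  visibly linear in the coefficients.\<close>

lemma mem_nonneg_preserving_polys_deg_iff:
  "p \<in> nonneg_preserving_polys_deg n m \<longleftrightarrow> degree p \<le> m \<and>
     (\<forall>A \<in> nonneg_matrices n. \<forall>i<n. \<forall>j<n. 0 \<le> (\<Sum>k\<le>m. coeff p k * (A ^\<^sub>m k) $$ (i, j)))"
proof -
  have "0\<^sub>m n n \<le> poly_mat p A \<longleftrightarrow>
      (\<forall>i<n. \<forall>j<n. 0 \<le> (\<Sum>k\<le>m. coeff p k * (A ^\<^sub>m k) $$ (i, j)))"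
    if "A \<in> nonneg_matrices n" "degree p \<le> m" for A
  proof -
    have A: "A \<in> carrier_mat n n"
      using that by (simp add: mem_nonneg_matrices_iff)
    then have "poly_mat p A \<in> carrier_mat n n"
      by (auto simp: poly_mat_def)
    then show ?thesis
      using poly_mat_index[OF A _ _ that(2)] by (auto simp: less_eq_mat_def)
  qed
  then show ?thesis
    by (auto simp: nonneg_preserving_polys_deg_def nonneg_preserving_polys_def)
qed

section \<open>Powers of nonnegative matrices and walks\<close>

lemma index_mult_mat_sum:
  assumes "A \<in> carrier_mat n n" "B \<in> carrier_mat n n" "i < n" "j < n"
  shows "(A * B) $$ (i, j) = (\<Sum>v<n. A $$ (i, v) * B $$ (v, j))"
proof -
  have "(A * B) $$ (i, j) = row A i \<bullet> col B j"
    using assms by (intro index_mult_mat) auto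
  also have "\<dots> = (\<Sum>v<n. A $$ (i, v) * B $$ (v, j))"
    unfolding scalar_prod_def using assms by (intro sum.cong) auto
  finally show ?thesis .
qed

lemma pow_mat_Suc_index:
  fixes A :: "'a :: semiring_1 mat"
  assumes "A \<in> carrier_mat n n" "i < n" "j < n"
  shows "(A ^\<^sub>m Suc k) $$ (i, j) = (\<Sum>v<n. (A ^\<^sub>m k) $$ (i, v) * A $$ (v, j))"
  unfolding pow_mat.simps(2) using assms by (intro index_mult_mat_sum) auto

lemma pow_mat_add:
  fixes A :: "'a :: semiring_1 mat"
  assumes "A \<in> carrier_mat n n"
  shows "A ^\<^sub>m (a + b) = A ^\<^sub>m a * A ^\<^sub>m b"
proof (induction b)
  case 0
  then show ?case
    using assms right_mult_one_mat'[of "A ^\<^sub>m a"] by simp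
next
  case (Suc b)
  then show ?case
    using assms assoc_mult_mat[of "A ^\<^sub>m a" n n "A ^\<^sub>m b" n A n] by simp
qed

lemma pow_mat_nonneg:
  fixes A :: "real mat"
  assumes "A \<in> nonneg_matrices n" "i < n" "j < n"
  shows "0 \<le> (A ^\<^sub>m k) $$ (i, j)"
  using assms(2,3)
proof (induction k arbitrary: i j)
  case 0
  have "dim_row A = n"
    using assms(1) by (auto simp: mem_nonneg_matrices_iff)
  with 0 show ?case
    by simp
next
  case (Suc k)
  have "A \<in> carrier_mat n n" "\<forall>i<n. \<forall>j<n. 0 \<le> A $$ (i, j)"
    using assms(1) by (auto simp: mem_nonneg_matrices_iff)
  then show ?case
    using Suc pow_mat_Suc_index[of A n i j k] by (auto simp del: pow_mat.simps intro!: sum_nonneg)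
qed

lemma pow_mat_supermultiplicative:
  fixes A :: "real mat"
  assumes A: "A \<in> nonneg_matrices n" and "i < n" "v < n" "j < n"
  shows "(A ^\<^sub>m a) $$ (i, v) * (A ^\<^sub>m b) $$ (v, j) \<le> (A ^\<^sub>m (a + b)) $$ (i, j)"
proof -
  have carrier: "A \<in> carrier_mat n n"
    using A by (simp add: mem_nonneg_matrices_iff)
  have "(A ^\<^sub>m (a + b)) $$ (i, j) = (\<Sum>u<n. (A ^\<^sub>m a) $$ (i, u) * (A ^\<^sub>m b) $$ (u, j))"
    unfolding pow_mat_add[OF carrier]
    by (rule index_mult_mat_sum) (use carrier assms in auto)
  also have "\<dots> \<ge> (A ^\<^sub>m a) $$ (i, v) * (A ^\<^sub>m b) $$ (v, j)"
    by (rule member_le_sum[where f = "\<lambda>u. (A ^\<^sub>m a) $$ (i, u) * (A ^\<^sub>m b) $$ (u, j)"])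
      (use assms pow_mat_nonneg[OF A] in auto)
  finally show ?thesis .
qed

text \<open>A walk is a function from times to vertices; keeping the time window \<open>s\<close> to \<open>t\<close> as a
  parameter lets a walk be cut into pieces without reindexing.\<close>

definition walk_weight :: "real mat \<Rightarrow> (nat \<Rightarrow> nat) \<Rightarrow> nat \<Rightarrow> nat \<Rightarrow> real" where
  "walk_weight A f s t = (\<Prod>l = s..<t. A $$ (f l, f (Suc l)))"

lemma walk_weight_nonneg:
  assumes "A \<in> nonneg_matrices n" "\<And>l. f l < n"
  shows "0 \<le> walk_weight A f s t"
  using assms by (auto simp: walk_weight_def mem_nonneg_matrices_iff intro!: prod_nonneg)

lemma walk_weight_concat:
  assumes "s \<le> t" "t \<le> u"
  shows "walk_weight A f s u = walk_weight A f s t * walk_weight A f t u"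
  using assms by (simp add: walk_weight_def prod.atLeastLessThan_concat)

lemma walk_weight_le_pow_mat:
  assumes A: "A \<in> nonneg_matrices n" and f: "\<And>l. f l < n" and "s \<le> t"
  shows "walk_weight A f s t \<le> (A ^\<^sub>m (t - s)) $$ (f s, f t)"
  using \<open>s \<le> t\<close>
proof (induction t rule: dec_induct)
  case base
  have "dim_row A = n"
    using A by (auto simp: mem_nonneg_matrices_iff)
  then show ?case
    using f[of s] by (simp add: walk_weight_def)
next
  case (step t)
  have carrier: "A \<in> carrier_mat n n"
    using A by (simp add: mem_nonneg_matrices_iff)
  have "walk_weight A f s (Suc t) = walk_weight A f s t * A $$ (f t, f (Suc t))"
    using step.hyps by (simp add: walk_weight_def)
  also have "\<dots> \<le> (A ^\<^sub>m (t - s)) $$ (f s, f t) * A $$ (f t, f (Suc t))"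
    using step.IH A f by (intro mult_right_mono) (auto simp: mem_nonneg_matrices_iff)
  also have "\<dots> = (A ^\<^sub>m (t - s)) $$ (f s, f t) * (A ^\<^sub>m 1) $$ (f t, f (Suc t))"
    using carrier by simp
  also have "\<dots> \<le> (A ^\<^sub>m (t - s + 1)) $$ (f s, f (Suc t))"
    using A f by (intro pow_mat_supermultiplicative)
  also have "t - s + 1 = Suc t - s"
    using step.hyps by simp
  finally show ?case .
qed

text \<open>An entry of \<open>A\<^sup>k\<close> is a sum of at most \<open>n\<^sup>k\<close> walk weights, so one of them is at least the
  average. The walk is chosen backwards from \<open>j\<close>, taking at each time a predecessor with the
  largest contribution. Positivity of the entry is what provides a walk when \<open>k = 0\<close>, where
  \<open>i\<close> and \<open>j\<close> have to coincide.\<close>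

lemma exists_heavy_walk:
  fixes A :: "real mat"
  assumes A: "A \<in> nonneg_matrices n" and "i < n" "j < n" "0 < (A ^\<^sub>m k) $$ (i, j)"
  obtains f where "\<And>l. f l < n" "f 0 = i" "f k = j"
    "(A ^\<^sub>m k) $$ (i, j) \<le> real n ^ k * walk_weight A f 0 k"
  using assms(3,4)
proof (induction k arbitrary: j thesis)
  case 0
  have "dim_row A = n"
    using A by (auto simp: mem_nonneg_matrices_iff)
  then have "(A ^\<^sub>m 0) $$ (i, j) = (if i = j then 1 else 0)"
    using 0(2) assms(2) by simp
  then show ?case
    using 0 assms(2) by (intro 0(1)[of "\<lambda>_. i"]) (auto simp: walk_weight_def split: if_splits)
next
  case (Suc k)
  have carrier: "A \<in> carrier_mat n n"
    using A by (simp add: mem_nonneg_matrices_iff)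
  define g where "g v = (A ^\<^sub>m k) $$ (i, v) * A $$ (v, j)" for v
  have sum: "(A ^\<^sub>m Suc k) $$ (i, j) = (\<Sum>v<n. g v)"
    unfolding g_def by (rule pow_mat_Suc_index) (use carrier assms Suc in auto)
  obtain v where v: "v < n" and max: "\<And>u. u < n \<Longrightarrow> g u \<le> g v"
  proof -
    have "finite (g ` {..<n})" "g ` {..<n} \<noteq> {}"
      using assms(2) by auto
    from Max_in[OF this] obtain v where "v < n" "g v = Max (g ` {..<n})"
      by auto
    then show thesis
      by (intro that[of v]) auto
  qed
  have le: "(A ^\<^sub>m Suc k) $$ (i, j) \<le> real n * g v"
    unfolding sum using sum_bounded_above[of "{..<n}" g "g v"] max by simp
  then have "0 < real n * g v"
    using Suc.prems(3) by linarith
  then have "0 < g v"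
    by (simp add: zero_less_mult_iff)
  then have "0 < (A ^\<^sub>m k) $$ (i, v)"
    using pow_mat_nonneg[OF A assms(2) v, of k] by (auto simp: g_def less_le)
  then obtain f where f: "\<And>l. f l < n" "f 0 = i" "f k = v"
    "(A ^\<^sub>m k) $$ (i, v) \<le> real n ^ k * walk_weight A f 0 k"
    using Suc.IH v by metis
  define h where "h = f(Suc k := j)"
  have h: "h l < n" "h 0 = i" "h (Suc k) = j" for l
    using f Suc.prems(2) by (auto simp: h_def)
  have "walk_weight A h 0 (Suc k) = walk_weight A f 0 k * A $$ (v, j)"
    using f(3) by (simp add: walk_weight_def h_def)
  moreover have "real n * g v \<le> real n * (real n ^ k * walk_weight A f 0 k * A $$ (v, j))"
    unfolding g_def using f(4) A v Suc.prems(2)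
    by (intro mult_left_mono mult_right_mono) (auto simp: mem_nonneg_matrices_iff)
  ultimately have "(A ^\<^sub>m Suc k) $$ (i, j)
      \<le> real n ^ Suc k * walk_weight A h 0 (Suc k)"
    using le by (simp add: mult_ac)
  with h show ?case
    by (rule Suc.prems(1))
qed

text \<open>With \<open>x\<close>, \<open>c\<close> and \<open>y\<close> the weights of the parts before, along and after the closed part of
  length \<open>d = t - s\<close>, this is \<open>x y\<close> times the inequality \<open>u \<le> (1 + u\<^sup>2) / 2\<close> for
  \<open>u = \<tau>\<^sup>d c\<close>, up to a common power of \<open>\<tau>\<close>: the walk without its closed part has
  weight \<open>x y\<close>, and with the closed part traversed twice it has weight \<open>x c\<^sup>2 y\<close>. The parameter \<open>\<tau>\<close> carries the rescaling of the
  variable.\<close>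

lemma closed_walk_am_gm:
  assumes A: "A \<in> nonneg_matrices n" and f: "\<And>l. f l < n"
    and st: "s < t" "t \<le> m" "f s = f t" and "0 \<le> \<tau>"
  shows "\<tau> ^ m * walk_weight A f 0 m
    \<le> (\<tau> ^ (m - (t - s)) * (A ^\<^sub>m (m - (t - s))) $$ (f 0, f m)
       + \<tau> ^ (m + (t - s)) * (A ^\<^sub>m (m + (t - s))) $$ (f 0, f m)) / 2"
proof -
  define x where "x = walk_weight A f 0 s"
  define c where "c = walk_weight A f s t"
  define y where "y = walk_weight A f t m"
  define v where "v = f s"
  define d where "d = t - s"
  have d: "d \<le> m" "m - d = s + (m - t)" "m + d = s + (d + (d + (m - t)))" "m = (m - d) + d"
    using st by (auto simp: d_def)
  have fv: "f 0 < n" "f m < n" "v < n"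
    using f by (auto simp: v_def)
  have nonneg: "0 \<le> x" "0 \<le> c" "0 \<le> y"
    using walk_weight_nonneg[of A n f] A f by (auto simp: x_def c_def y_def)
  have split: "walk_weight A f 0 m = x * c * y"
    using st walk_weight_concat[of 0 s m A f] walk_weight_concat[of s t m A f]
    by (simp add: x_def c_def y_def)
  have x: "x \<le> (A ^\<^sub>m s) $$ (f 0, v)" and c: "c \<le> (A ^\<^sub>m d) $$ (v, v)"
    and y: "y \<le> (A ^\<^sub>m (m - t)) $$ (v, f m)"
    using walk_weight_le_pow_mat[of A n f 0 s] walk_weight_le_pow_mat[of A n f s t]
      walk_weight_le_pow_mat[of A n f t m] A f st
    by (auto simp: x_def c_def y_def v_def d_def)
  have prepend: "w * z \<le> (A ^\<^sub>m (a + b)) $$ (u, f m)"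
    if "w \<le> (A ^\<^sub>m a) $$ (u, v)" "z \<le> (A ^\<^sub>m b) $$ (v, f m)" "0 \<le> z" "u < n" for w z a b u
  proof -
    have "w * z \<le> (A ^\<^sub>m a) $$ (u, v) * (A ^\<^sub>m b) $$ (v, f m)"
      using that pow_mat_nonneg[OF A, of u v a] fv by (intro mult_mono) auto
    also have "\<dots> \<le> (A ^\<^sub>m (a + b)) $$ (u, f m)"
      using A that fv by (intro pow_mat_supermultiplicative) auto
    finally show ?thesis .
  qed
  have deleted: "x * y \<le> (A ^\<^sub>m (m - d)) $$ (f 0, f m)"
    unfolding d(2) using x y nonneg fv by (intro prepend)
  have doubled: "x * (c * (c * y)) \<le> (A ^\<^sub>m (m + d)) $$ (f 0, f m)"
    unfolding d(3) using x c y nonneg fv by (intro prepend mult_nonneg_nonneg)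
  have "\<tau> ^ m * walk_weight A f 0 m = \<tau> ^ (m - d) * (x * y) * (\<tau> ^ d * c)"
    unfolding split using power_add[of \<tau> "m - d" d] d(4) by (simp add: mult_ac)
  also have "\<dots> \<le> \<tau> ^ (m - d) * (x * y) * ((1 + (\<tau> ^ d * c)\<^sup>2) / 2)"
    using nonneg \<open>0 \<le> \<tau>\<close> sum_squares_bound[of 1 "\<tau> ^ d * c"] by (intro mult_left_mono) auto
  also have "\<dots> = (\<tau> ^ (m - d) * (x * y) + \<tau> ^ (m - d + d + d) * (x * (c * (c * y)))) / 2"
    by (simp add: power_add power2_eq_square field_simps)
  also have "\<dots> = (\<tau> ^ (m - d) * (x * y) + \<tau> ^ (m + d) * (x * (c * (c * y)))) / 2"
    using d(4) by simp
  also have "\<dots> \<le> (\<tau> ^ (m - d) * (A ^\<^sub>m (m - d)) $$ (f 0, f m)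
       + \<tau> ^ (m + d) * (A ^\<^sub>m (m + d)) $$ (f 0, f m)) / 2"
    using deleted doubled \<open>0 \<le> \<tau>\<close> by (intro divide_right_mono add_mono mult_left_mono) auto
  finally show ?thesis
    by (simp add: d_def)
qed

text \<open>By the pigeonhole principle the \<open>n + 1\<close> vertices visited by a heavy walk of length \<open>n\<close>
  contain a repetition, so the preceding inequality applies with \<open>1 \<le> d \<le> n\<close>; the exponents
  \<open>n - d\<close> and \<open>n + d\<close> then differ from \<open>n\<close> and are at most \<open>2 n\<close>.\<close>

lemma middle_power_le_other_powers:
  assumes A: "A \<in> nonneg_matrices n" and ij: "i < n" "j < n" and "0 \<le> \<tau>"
  shows "\<tau> ^ n * (A ^\<^sub>m n) $$ (i, j)
    \<le> real n ^ n * (\<Sum>k \<in> {..2 * n} - {n}. \<tau> ^ k * (A ^\<^sub>m k) $$ (i, j))"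
    (is "_ \<le> _ * (\<Sum>k \<in> ?K. ?a k)")
proof (cases "(A ^\<^sub>m n) $$ (i, j) = 0")
  case True
  then show ?thesis
    using pow_mat_nonneg[OF A ij] \<open>0 \<le> \<tau>\<close> by (auto intro!: mult_nonneg_nonneg sum_nonneg)
next
  case False
  then have "0 < (A ^\<^sub>m n) $$ (i, j)"
    using pow_mat_nonneg[OF A ij, of n] by simp
  then obtain f where f: "\<And>l. f l < n" "f 0 = i" "f n = j"
    and heavy: "(A ^\<^sub>m n) $$ (i, j) \<le> real n ^ n * walk_weight A f 0 n"
    using exists_heavy_walk[OF A ij] by metis
  have "\<not> inj_on f {..n}"
  proof (rule pigeonhole)
    have "card (f ` {..n}) \<le> card {..<n}"
      using f(1) by (intro card_mono) auto
    then show "card (f ` {..n}) < card {..n}"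
      by simp
  qed
  then obtain s t where st: "s < t" "t \<le> n" "f s = f t"
    unfolding inj_on_def by (metis atMost_iff linorder_neqE_nat)
  let ?d = "t - s"
  have "\<tau> ^ n * walk_weight A f 0 n \<le> (?a (n - ?d) + ?a (n + ?d)) / 2"
    using closed_walk_am_gm[of A n f s t n \<tau>] A st f \<open>0 \<le> \<tau>\<close> by simp
  also have "\<dots> \<le> (\<Sum>k\<in>?K. ?a k)"
  proof -
    have nonneg: "0 \<le> ?a k" for k
      using pow_mat_nonneg[OF A ij] \<open>0 \<le> \<tau>\<close> by simp
    have "?a (n - ?d) \<le> (\<Sum>k\<in>?K. ?a k)" "?a (n + ?d) \<le> (\<Sum>k\<in>?K. ?a k)"
      using nonneg st by (auto intro!: member_le_sum[of _ ?K ?a])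
    then show ?thesis
      by simp
  qed
  finally have bound: "\<tau> ^ n * walk_weight A f 0 n \<le> (\<Sum>k\<in>?K. ?a k)" .
  have "\<tau> ^ n * (A ^\<^sub>m n) $$ (i, j) \<le> \<tau> ^ n * (real n ^ n * walk_weight A f 0 n)"
    using heavy \<open>0 \<le> \<tau>\<close> by (intro mult_left_mono) auto
  also have "\<dots> = real n ^ n * (\<tau> ^ n * walk_weight A f 0 n)"
    by simp
  also have "\<dots> \<le> real n ^ n * (\<Sum>k\<in>?K. ?a k)"
    using bound by (intro mult_left_mono) auto
  finally show ?thesis .
qed

section \<open>Members with a negative middle coefficient\<close>

lemma negative_middle_coeff_exists:
  assumes "1 \<le> n" "0 \<le> \<tau>"
  obtains p where "p \<in> nonneg_preserving_polys_deg n (2 * n)"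
    "coeff p 0 = real n ^ n" "coeff p n = - (\<tau> ^ n)"
proof
  define c where "c k = (if k = n then - (\<tau> ^ n) else real n ^ n * \<tau> ^ k)" for k
  let ?p = "\<Sum>k\<le>2 * n. monom (c k) k"
  have coeff: "coeff ?p k = c k" if "k \<le> 2 * n" for k
    using that by (simp add: coeff_sum)
  then show "coeff ?p 0 = real n ^ n" "coeff ?p n = - (\<tau> ^ n)"
    using assms by (auto simp: c_def)
  have "degree ?p \<le> 2 * n"
    by (intro degree_sum_le) (auto intro: order.trans[OF degree_monom_le])
  moreover have "0 \<le> (\<Sum>k\<le>2 * n. coeff ?p k * (A ^\<^sub>m k) $$ (i, j))"
    if A: "A \<in> nonneg_matrices n" and ij: "i < n" "j < n" for A i j
  proof -
    have "(\<Sum>k\<le>2 * n. coeff ?p k * (A ^\<^sub>m k) $$ (i, j)) = (\<Sum>k\<le>2 * n. c k * (A ^\<^sub>m k) $$ (i, j))"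
      by (intro sum.cong) (auto simp only: coeff atMost_iff)
    also have "\<dots> = c n * (A ^\<^sub>m n) $$ (i, j) + (\<Sum>k \<in> {..2 * n} - {n}. c k * (A ^\<^sub>m k) $$ (i, j))"
      by (intro sum.remove) auto
    also have "(\<Sum>k \<in> {..2 * n} - {n}. c k * (A ^\<^sub>m k) $$ (i, j))
        = real n ^ n * (\<Sum>k \<in> {..2 * n} - {n}. \<tau> ^ k * (A ^\<^sub>m k) $$ (i, j))"
      by (auto simp: c_def sum_distrib_left mult.assoc intro!: sum.cong)
    finally show ?thesis
      using middle_power_le_other_powers[OF A ij \<open>0 \<le> \<tau>\<close>] by (simp add: c_def)
  qed
  ultimately show "?p \<in> nonneg_preserving_polys_deg n (2 * n)"
    by (simp only: mem_nonneg_preserving_polys_deg_iff) blast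
qed

section \<open>Constraints from cyclic shifts\<close>

definition cyclic_shift :: "nat \<Rightarrow> real \<Rightarrow> real mat" where
  "cyclic_shift n s = mat n n (\<lambda>(i, j). if j = Suc i mod n then s else 0)"

text \<open>A vertex of the directed cycle has exactly one walk of each length starting from it.\<close>

lemma cyclic_shift_pow_index:
  assumes "i < n" "j < n"
  shows "(cyclic_shift n s ^\<^sub>m k) $$ (i, j) = (if j = (i + k) mod n then s ^ k else 0)"
  using assms(2)
proof (induction k arbitrary: j)
  case 0
  then show ?case
    using assms(1) by (auto simp: cyclic_shift_def)
next
  case (Suc k)
  have "(cyclic_shift n s ^\<^sub>m Suc k) $$ (i, j)
      = (\<Sum>v<n. (cyclic_shift n s ^\<^sub>m k) $$ (i, v) * cyclic_shift n s $$ (v, j))"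
    by (rule pow_mat_Suc_index) (use assms(1) Suc.prems in \<open>auto simp: cyclic_shift_def\<close>)
  also have "\<dots> = (\<Sum>v<n. if v = (i + k) mod n then s ^ k * cyclic_shift n s $$ (v, j) else 0)"
    using Suc.IH by (intro sum.cong) auto
  also have "\<dots> = s ^ k * cyclic_shift n s $$ ((i + k) mod n, j)"
    using assms(1) by (simp add: sum.delta)
  also have "\<dots> = (if j = (i + Suc k) mod n then s ^ Suc k else 0)"
    using assms(1) Suc.prems by (simp add: cyclic_shift_def mod_Suc_eq)
  finally show ?case .
qed

lemma nonneg_preserving_quadratic:
  assumes "1 \<le> n" "p \<in> nonneg_preserving_polys_deg n (2 * n)" "0 \<le> s"
  shows "0 \<le> coeff p 0 + coeff p n * s ^ n + coeff p (2 * n) * s ^ (2 * n)"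
proof -
  have "cyclic_shift n s \<in> nonneg_matrices n"
    using assms(3) by (auto simp: cyclic_shift_def mem_nonneg_matrices_iff)
  then have "0 \<le> (\<Sum>k\<le>2 * n. coeff p k * (cyclic_shift n s ^\<^sub>m k) $$ (0, 0))"
    using assms(1,2) by (auto simp: mem_nonneg_preserving_polys_deg_iff)
  also have "\<dots> = (\<Sum>k\<le>2 * n. if n dvd k then coeff p k * s ^ k else 0)"
    using assms(1) by (intro sum.cong) (auto simp: cyclic_shift_pow_index mod_eq_0_iff_dvd)
  also have "\<dots> = (\<Sum>k \<in> {0, n, 2 * n}. coeff p k * s ^ k)"
  proof (rule sum.mono_neutral_cong_right)
    have "k \<in> {0, n, 2 * n}" if "k \<le> 2 * n" "n dvd k" for k
    proof -
      obtain q where q: "k = n * q"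
        using \<open>n dvd k\<close> ..
      with that assms(1) have "q \<le> 2"
        by simp
      then have "q = 0 \<or> q = 1 \<or> q = 2"
        by arith
      then show ?thesis
        using q by auto
    qed
    then show "\<forall>k \<in> {..2 * n} - {0, n, 2 * n}. (if n dvd k then coeff p k * s ^ k else 0) = 0"
      by auto
  qed auto
  also have "\<dots> = coeff p 0 + coeff p n * s ^ n + coeff p (2 * n) * s ^ (2 * n)"
    using assms(1) by simp
  finally show ?thesis .
qed

lemma nonneg_preserving_coeff_0:
  assumes "1 \<le> n" "p \<in> nonneg_preserving_polys_deg n (2 * n)"
  shows "0 \<le> coeff p 0"
  using nonneg_preserving_quadratic[OF assms, of 0] assms(1) by (simp add: power_0_left)

text \<open>Without a constant term the quadratic constraint can be divided by \<open>s\<^sup>n\<close>; letting \<open>s\<close>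
  tend to zero then leaves only the middle coefficient.\<close>

lemma nonneg_preserving_middle_coeff:
  assumes "1 \<le> n" "p \<in> nonneg_preserving_polys_deg n (2 * n)" "coeff p 0 = 0"
  shows "0 \<le> coeff p n"
proof (rule ccontr)
  define b c where "b = - coeff p n" and "c = coeff p (2 * n)"
  assume "\<not> 0 \<le> coeff p n"
  then have b: "0 < b"
    by (simp add: b_def)
  \<comment> \<open>Small enough that \<open>c s\<^sup>n < b\<close>: since \<open>s \<le> 1\<close>, already \<open>s\<^sup>n \<le> s\<close>.\<close>
  define s where "s = min 1 (b / (2 * (\<bar>c\<bar> + 1)))"
  have s: "0 < s" "s \<le> 1"
    using b by (auto simp: s_def)
  have "s ^ n \<le> s ^ 1"
    using assms(1) s by (intro power_decreasing) auto
  also have "\<dots> \<le> b / (2 * (\<bar>c\<bar> + 1))"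
    by (simp add: s_def)
  finally have "2 * s ^ n + 2 * (\<bar>c\<bar> * s ^ n) \<le> b"
    by (simp add: pos_le_divide_eq algebra_simps)
  moreover have "0 < s ^ n"
    using s by simp
  moreover have "c * s ^ n \<le> \<bar>c\<bar> * s ^ n"
    using s by (intro mult_right_mono) auto
  moreover have "0 \<le> \<bar>c\<bar> * s ^ n"
    using s by simp
  ultimately have "c * s ^ n < b"
    by linarith
  moreover have "0 \<le> s ^ n * (c * s ^ n - b)"
  proof -
    have "s ^ (2 * n) = s ^ n * s ^ n"
      by (simp add: mult_2 power_add)
    then have "s ^ n * (c * s ^ n - b) = coeff p 0 + coeff p n * s ^ n + coeff p (2 * n) * s ^ (2 * n)"
      using assms(3) by (simp add: b_def c_def algebra_simps)
    then show ?thesis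
      using nonneg_preserving_quadratic[OF assms(1,2), of s] s by simp
  qed
  ultimately show False
    using \<open>0 < s ^ n\<close> by (simp add: zero_le_mult_iff)
qed

section \<open>Finitely generated cones\<close>

lemma cone_of_generator:
  assumes "x \<in> S"
  shows "x \<in> cone_of S"
  unfolding cone_of_def
  using assms by (auto intro!: exI[of _ "Suc 0"] exI[of _ "\<lambda>_. 1 :: real"] exI[of _ "\<lambda>_. x"])

lemma cone_of_halfspace:
  assumes "q \<in> cone_of S" "\<And>x. x \<in> S \<Longrightarrow> 0 \<le> K * coeff x a + coeff x b"
  shows "0 \<le> K * coeff q a + coeff q b"
proof -
  obtain k :: nat and \<alpha> x where \<alpha>: "\<forall>i<k. \<alpha> i \<ge> 0 \<and> x i \<in> S"
    and q: "q = (\<Sum>i<k. smult (\<alpha> i) (x i))"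
    using assms(1) unfolding cone_of_def by blast
  have "K * coeff q a + coeff q b = (\<Sum>i<k. \<alpha> i * (K * coeff (x i) a + coeff (x i) b))"
    unfolding q by (simp add: coeff_sum sum_distrib_left sum.distrib algebra_simps)
  also have "\<dots> \<ge> 0"
    using \<alpha> assms(2) by (auto intro!: sum_nonneg)
  finally show ?thesis .
qed

text \<open>Each generator \<open>x\<close> admits its own constant, the ratio of the two coefficients; it is a
  harmless zero when \<open>coeff x a = 0\<close>. The sum of these ratios serves all generators at once, and
  the resulting half-space is inherited by the cone.\<close>

lemma finitely_generated_coeff_bound:
  assumes "finite S" "\<And>x. x \<in> S \<Longrightarrow> 0 \<le> coeff x a"
    "\<And>x. x \<in> S \<Longrightarrow> coeff x a = 0 \<Longrightarrow> 0 \<le> coeff x b"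
  obtains K where "0 \<le> K" "\<And>q. q \<in> cone_of S \<Longrightarrow> 0 \<le> K * coeff q a + coeff q b"
proof
  define r where "r x = \<bar>coeff x b\<bar> / coeff x a" for x :: "real poly"
  let ?K = "\<Sum>x\<in>S. r x"
  have r: "0 \<le> r x" if "x \<in> S" for x
    using assms(2) that by (simp add: r_def)
  then show "0 \<le> ?K"
    by (rule sum_nonneg)
  have "0 \<le> ?K * coeff x a + coeff x b" if x: "x \<in> S" for x
  proof (cases "coeff x a = 0")
    case True
    then show ?thesis
      using assms(3) x by simp
  next
    case False
    then have "- coeff x b \<le> r x * coeff x a"
      by (simp add: r_def)
    also have "\<dots> \<le> ?K * coeff x a"
      using assms(1,2) r x by (intro mult_right_mono member_le_sum) auto
    finally show ?thesis
      by simp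
  qed
  then show "0 \<le> ?K * coeff q a + coeff q b" if "q \<in> cone_of S" for q
    using that by (rule cone_of_halfspace[rotated])
qed

theorem theorem3p3:
  fixes n :: nat
  assumes "n \<ge> 1"
  shows "\<not> polyhedral_cone (nonneg_preserving_polys_deg n (2 * n))"
proof
  assume "polyhedral_cone (nonneg_preserving_polys_deg n (2 * n))"
  then obtain S where "finite S" and S: "nonneg_preserving_polys_deg n (2 * n) = cone_of S"
    unfolding polyhedral_cone_def by blast
  have gen: "x \<in> nonneg_preserving_polys_deg n (2 * n)" if "x \<in> S" for x
    using that cone_of_generator S by simp
  obtain K where "0 \<le> K" and K: "\<And>q. q \<in> cone_of S \<Longrightarrow> 0 \<le> K * coeff q 0 + coeff q n"
    using finitely_generated_coeff_bound[of S 0 n] \<open>finite S\<close> gen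
      nonneg_preserving_coeff_0[OF assms] nonneg_preserving_middle_coeff[OF assms] by metis
  \<comment> \<open>Chosen so that \<open>\<tau>\<^sup>n \<ge> \<tau> > K n\<^sup>n\<close>.\<close>
  define \<tau> where "\<tau> = K * real n ^ n + 1"
  have "1 \<le> \<tau>"
    using \<open>0 \<le> K\<close> by (simp add: \<tau>_def)
  then obtain p where p: "p \<in> nonneg_preserving_polys_deg n (2 * n)"
    "coeff p 0 = real n ^ n" "coeff p n = - (\<tau> ^ n)"
    using negative_middle_coeff_exists[OF assms, of \<tau>] by auto
  have "\<tau> ^ 1 \<le> \<tau> ^ n"
    using assms \<open>1 \<le> \<tau>\<close> by (rule power_increasing)
  moreover have "\<tau> ^ n \<le> K * real n ^ n"
    using K[of p] p S by simp
  ultimately show False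
    by (simp add: \<tau>_def)
qed

end
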